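(* Let $b\in\{5,7,11,13,21,23,27,29\}$. The Diophantine equation $$(2^k-1)(b^k-1)=x^n$$ has no solution in positive integers $(k,x,n)$ with $k\ge 2$ and $n\ge 2$, except for the solution $(2^2-1)(7^2-1)=12^2$, i.e. $b=7$ and $(k,x,n)=(2,12,2)$. *)

theory Defs imports Main begin

end

theory Submission imports Defs "HOL-Number_Theory.Number_Theory" begin

text \<open>
  It suffices to treat \<open>n = 2\<close> and odd primes \<open>n = p\<close>.

  Squares: odd \<open>k\<close> is excluded by congruences. For \<open>k = 2 m\<close> put \<open>X = 2\<^sup>m\<close> and \<open>Y = b\<^sup>m\<close>, so that
  \<open>(X\<^sup>2 - 1) (Y\<^sup>2 - 1)\<close> is a square. Both \<open>X\<close> and \<open>Y\<close> are values of Chebyshev polynomials at a common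
  point, and as \<open>Y\<close> is odd a descent shows that \<open>4 X\<^sup>2\<close> divides \<open>Y\<^sup>2 - 1 = b\<^sup>k - 1\<close>. By lifting the
  exponent this forces \<open>m = 1\<close>.

  Odd primes \<open>p\<close>: a congruence modulo 8 shows that \<open>k\<close> is even, and then every \<open>m \<le> p\<close> divides \<open>k\<close>. Indeed, if
  \<open>q \<le> p\<close> is prime and \<open>q - 1\<close> divides \<open>k\<close>, then \<open>q\<close> divides \<open>x\<close>, so \<open>q\<^sup>p\<close> divides the left-hand side,
  and lifting the exponent shows that \<open>k\<close> is divisible by a large power of \<open>q\<close>. In particular
  \<open>k = p l\<close>. With \<open>X = 2\<^sup>l\<close> and \<open>Y = b\<^sup>l\<close> we get \<open>(X\<^sup>p - 1) (Y\<^sup>p - 1) = x\<^sup>p\<close>. For \<open>p \<ge> 7\<close> the left-hand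
  side lies strictly between \<open>(X Y - 1)\<^sup>p\<close> and \<open>(X Y)\<^sup>p\<close>. For \<open>p = 3\<close> and \<open>p = 5\<close> a Pade approximant
  of \<open>(1 - t)\<^bsup>1/p\<^esup>\<close> yields an integer strictly between 0 and 1; this uses \<open>b < 32\<close>.
\<close>

section \<open>Lifting the exponent\<close>

lemma sum_powers_cong_length:
  fixes A q :: int
  assumes "q dvd A - 1"
  shows "[(\<Sum>i<t. A ^ i) = int t] (mod q)"
proof -
  have A: "[A = 1] (mod q)" using assms by (simp add: cong_iff_dvd_diff)
  have "[A ^ i = 1] (mod q)" for i using cong_pow[OF A, of i] by simp
  hence "[(\<Sum>i<t. A ^ i) = (\<Sum>i<t. 1)] (mod q)" by (intro cong_sum) auto
  thus ?thesis by simp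
qed

text \<open>With \<open>A = 1 + q * u\<close>, the power \<open>A ^ i\<close> is
  \<open>1 + i * q * u\<close> modulo \<open>q^2\<close>, and the linear terms add up to
  \<open>q * u\<close> times \<open>q * (q - 1) / 2\<close>, which vanishes for odd
  \<open>q\<close>. Hence the sum contains exactly one factor \<open>q\<close>; for
  \<open>q = 2\<close> this needs \<open>A = 1\<close> modulo 4.\<close>

lemma sum_powers_cong_square:
  fixes A :: int and q :: nat
  assumes "prime q" "int q dvd A - 1" "q = 2 \<Longrightarrow> 4 dvd A - 1"
  shows "[(\<Sum>i<q. A ^ i) = int q] (mod (int q)\<^sup>2)"
proof (cases "q = 2")
  case True
  with assms(3) have "[A + 1 = 2] (mod 4)" by (simp add: cong_iff_dvd_diff)
  thus ?thesis using True by (simp add: numeral_2_eq_2 add.commute)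
next
  case False
  with assms(1) have "odd q" using primes_dvd_imp_eq two_is_prime_nat by blast
  then obtain h where h: "q = 2 * h + 1" by (elim oddE)
  obtain u where u: "A = 1 + int q * u" using assms(2) by (metis dvdE add.commute diff_add_cancel)
  have "[A ^ i = 1 + int i * (int q * u)] (mod (int q)\<^sup>2)" for i
  proof (induction i)
    case (Suc i)
    have "[A ^ Suc i = A * (1 + int i * (int q * u))] (mod (int q)\<^sup>2)"
      using cong_scalar_left[OF Suc, of A] by simp
    also have "A * (1 + int i * (int q * u)) =
        1 + int (Suc i) * (int q * u) + (int q)\<^sup>2 * (int i * u\<^sup>2)"
      by (simp add: u algebra_simps power2_eq_square)
    also have "[\<dots> = 1 + int (Suc i) * (int q * u)] (mod (int q)\<^sup>2)"
      by (simp add: cong_iff_dvd_diff)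
    finally show ?case .
  qed simp
  hence "[(\<Sum>i<q. A ^ i) = (\<Sum>i<q. 1 + int i * (int q * u))] (mod (int q)\<^sup>2)"
    by (intro cong_sum) auto
  also have "(\<Sum>i<q. 1 + int i * (int q * u)) = int q + (\<Sum>i<q. int i) * (int q * u)"
    by (simp add: sum.distrib sum_distrib_right)
  also have "(\<Sum>i<q. int i) = int q * int h"
  proof -
    have "2 * (\<Sum>i<n. int i) = int n * (int n - 1)" for n
      by (induction n) (auto simp: algebra_simps)
    from this[of q] show ?thesis using h by simp
  qed
  also have "[int q + int q * int h * (int q * u) = int q] (mod (int q)\<^sup>2)"
    by (simp add: cong_iff_dvd_diff power2_eq_square)
  finally show ?thesis .
qed

text \<open>Strong induction strips one factor \<open>q\<close> from \<open>t\<close> at a time: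
  \<open>A ^ (s * q) - 1\<close> is \<open>A ^ s - 1\<close> times a geometric sum with exactly one
  factor \<open>q\<close>. Once \<open>q\<close> no longer divides \<open>t\<close>, the geometric
  sum is congruent to \<open>t\<close> and contributes nothing.\<close>

lemma lifting_the_exponent:
  fixes A :: int and q :: nat
  assumes q: "prime q" and "int q dvd A - 1" "q = 2 \<Longrightarrow> 4 dvd A - 1" and "A > 1" "t > 0"
  shows "multiplicity (int q) (A ^ t - 1) = multiplicity (int q) (A - 1) + multiplicity q t"
  using assms(5)
proof (induction t rule: less_induct)
  case (less t)
  have pq: "prime_elem (int q)" using q by simp
  show ?case
  proof (cases "q dvd t")
    case False
    have "\<not> int q dvd (\<Sum>i<t. A ^ i)"
      using cong_dvd_iff[OF sum_powers_cong_length[OF assms(2), of t]] False by simp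
    moreover have "(\<Sum>i<t. A ^ i) > 0" using less.prems \<open>A > 1\<close> by (intro sum_pos) auto
    ultimately show ?thesis
      unfolding power_diff_1_eq[of A t] using \<open>A > 1\<close> False pq
      by (subst prime_elem_multiplicity_mult_distrib) (auto simp: not_dvd_imp_multiplicity_0)
  next
    case True
    then obtain s where s: "t = s * q" by (metis dvdE mult.commute)
    with less.prems q have s0: "0 < s" "s < t" using prime_gt_1_nat[OF q] by auto
    let ?B = "A ^ s" and ?S = "\<Sum>i<q. (A ^ s) ^ i"
    have dB: "A - 1 dvd ?B - 1" by (simp add: power_diff_1_eq)
    have B1: "?B > 1" using \<open>A > 1\<close> s0 by (simp add: one_less_power)
    have cong: "[?S = int q] (mod (int q)\<^sup>2)"
      using assms(2,3) dB by (intro sum_powers_cong_square q) (auto intro: dvd_trans)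
    have q1: "int q > 1" using prime_gt_1_nat[OF q] by simp
    have "multiplicity (int q) ?S = 1"
    proof (rule multiplicity_eqI)
      have "[?S = int q] (mod int q)" using cong by (rule cong_dvd_modulus) simp
      thus "int q ^ 1 dvd ?S" using cong_dvd_iff by fastforce
      have "\<not> (int q)\<^sup>2 dvd int q" using q1 by (auto simp: power2_eq_square dest: zdvd_imp_le)
      thus "\<not> int q ^ Suc 1 dvd ?S" using cong_dvd_iff[OF cong] by (simp add: numeral_2_eq_2)
    qed
    moreover have "?S > 0" using \<open>A > 1\<close> q1 by (intro sum_pos) (auto simp: zero_less_power)
    moreover have "A ^ t - 1 = (?B - 1) * ?S"
      unfolding s by (simp add: power_mult power_diff_1_eq[of "A ^ s" q])
    moreover have "multiplicity q t = multiplicity q s + 1"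
      unfolding s using s0 q by (subst prime_elem_multiplicity_mult_distrib) auto
    ultimately show ?thesis using less.IH[OF s0(2,1)] B1 pq
      by (simp add: prime_elem_multiplicity_mult_distrib)
  qed
qed

section \<open>Divisors of the exponent \<open>k\<close> when the right-hand side is an odd
  power\<close>

text \<open>The factors \<open>u - 1\<close> and \<open>u + 1\<close> differ by 2, so an odd prime
  divides at most one of them, and the whole prime power divides the other.\<close>

lemma prime_power_dvd_square_minus_one_le:
  fixes u :: int and q :: nat
  assumes "prime q" "odd q" "u > 1" and dvd: "int q ^ e dvd u\<^sup>2 - 1"
  shows "int q ^ e \<le> u + 1"
proof -
  have prod: "u\<^sup>2 - 1 = (u - 1) * (u + 1)" by (simp add: power2_eq_square algebra_simps)
  have "q \<ge> 3" using assms(1,2) prime_ge_2_nat[of q] by (cases "q = 2") auto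
  hence "\<not> int q dvd (u + 1) - (u - 1)" by (auto dest: zdvd_imp_le)
  hence "\<not> int q dvd u - 1 \<or> \<not> int q dvd u + 1" using dvd_diff by blast
  hence "coprime (int q ^ e) (u - 1) \<or> coprime (int q ^ e) (u + 1)"
    using assms(1) by (auto intro: prime_imp_coprime)
  hence "int q ^ e dvd u + 1 \<or> int q ^ e dvd u - 1"
    using dvd unfolding prod by (auto simp: coprime_dvd_mult_right_iff coprime_dvd_mult_left_iff)
  thus ?thesis using zdvd_imp_le[of "int q ^ e" "u + 1"] zdvd_imp_le[of "int q ^ e" "u - 1"] \<open>u > 1\<close>
    by linarith
qed

text \<open>The cases 3, 5 and 7 are evaluated. For \<open>q = 2 * h + 1 \<ge> 9\<close>, both
  factors have the form \<open>u^2 - 1\<close>, so their \<open>q\<close>-parts are at most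
  \<open>2 ^ h + 1\<close> and \<open>b ^ h + 1\<close>. Since
  \<open>2 * b \<le> 58 < 81 \<le> q^2\<close>, the product of these bounds is at most
  \<open>4 * q ^ (2 * h) < q ^ q\<close>.\<close>

lemma not_power_dvd_fermat_product:
  fixes b :: int and q :: nat
  assumes "b \<in> {5, 7, 11, 13, 21, 23, 27, 29}" and q: "prime q" "odd q"
  shows "\<not> int q ^ q dvd (2 ^ (q - 1) - 1) * (b ^ (q - 1) - 1)"
proof -
  have "q \<noteq> 2" "q \<ge> 2" using q prime_ge_2_nat by auto
  hence "q = 3 \<or> q = 5 \<or> q = 7 \<or> q \<ge> 9" using q(2) by presburger
  then consider "q \<in> {3, 5, 7}" | "q \<ge> 9" by blast
  thus ?thesis
  proof cases
    case 1
    thus ?thesis using assms(1) by auto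
  next
    case 2
    obtain h where h: "q = 2 * h + 1" using q(2) by (elim oddE)
    have "h > 0" using 2 h by simp
    have b: "1 < b" "b \<le> 29" using assms(1) by auto
    let ?m = "multiplicity (int q)"
    have bound: "int q ^ ?m (a ^ (q - 1) - 1) \<le> a ^ h + 1" if "a > 1" for a :: int
    proof (rule prime_power_dvd_square_minus_one_le[OF q])
      show "a ^ h > 1" using that \<open>h > 0\<close> by (rule one_less_power)
      show "int q ^ ?m (a ^ (q - 1) - 1) dvd (a ^ h)\<^sup>2 - 1"
        using multiplicity_dvd[of "int q" "a ^ (q - 1) - 1"] by (simp add: h power_even_eq)
    qed
    have nz: "(2::int) ^ (q - 1) > 1" "b ^ (q - 1) > 1" using 2 b by (auto intro: one_less_power)
    hence "?m ((2 ^ (q - 1) - 1) * (b ^ (q - 1) - 1)) = ?m (2 ^ (q - 1) - 1) + ?m (b ^ (q - 1) - 1)"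
      using q by (intro prime_elem_multiplicity_mult_distrib) auto
    hence "int q ^ ?m ((2 ^ (q - 1) - 1) * (b ^ (q - 1) - 1)) =
        int q ^ ?m (2 ^ (q - 1) - 1) * int q ^ ?m (b ^ (q - 1) - 1)" by (simp add: power_add)
    also have "\<dots> \<le> (2 ^ h + 1) * (b ^ h + 1)"
      using bound[of 2] bound[of b] b by (intro mult_mono) auto
    also have "\<dots> \<le> (2 * 2 ^ h) * (2 * b ^ h)" using b by (intro mult_mono) auto
    also have "\<dots> = 4 * (2 * b) ^ h" by (simp add: power_mult_distrib)
    also have "\<dots> \<le> 4 * (int q * int q) ^ h"
      using b mult_mono[of 9 "int q" 9 "int q"] 2 by (intro mult_left_mono power_mono) auto
    also have "\<dots> < int q * (int q * int q) ^ h" using 2 by (intro mult_strict_right_mono) auto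
    also have "\<dots> = int q ^ q" using h by (simp add: power_mult power2_eq_square)
    finally have "?m ((2 ^ (q - 1) - 1) * (b ^ (q - 1) - 1)) < q"
      using 2 by (simp add: power_strict_increasing_iff)
    moreover have "(2 ^ (q - 1) - 1) * (b ^ (q - 1) - 1) \<noteq> 0" using nz 2 by simp
    ultimately show ?thesis using q
      by (metis multiplicity_geI not_less prime_elem_not_unit prime_imp_prime_elem prime_nat_int_transfer)
  qed
qed

lemma fermat_int:
  fixes a :: int and q :: nat
  assumes "prime q" "\<not> int q dvd a"
  shows "int q dvd a ^ (q - 1) - 1"
proof -
  have "[nat (a mod int q) ^ (q - 1) = 1] (mod q)"
  proof (rule fermat_theorem[OF assms(1)])
    have "int q > 0" using assms(1) prime_gt_0_nat by simp
    thus "\<not> q dvd nat (a mod int q)"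
      using assms(2) by (simp add: int_dvd_int_iff[symmetric] dvd_mod_iff del: int_dvd_int_iff)
  qed
  hence "[int (nat (a mod int q)) ^ (q - 1) = 1] (mod int q)"
    by (simp flip: cong_int_iff)
  moreover have "int q > 0" using assms(1) prime_gt_0_nat by simp
  ultimately have "[a ^ (q - 1) = 1] (mod int q)"
    by (simp add: cong_def power_mod)
  thus ?thesis by (simp add: cong_iff_dvd_diff)
qed

text \<open>If \<open>q\<close> does not divide \<open>a\<close>, Fermat and lifting the exponent
  give equality. The inequality also covers \<open>q\<close> dividing \<open>a\<close>, where the
  left side is 0.\<close>

lemma multiplicity_power_minus_one:
  fixes a :: int and q :: nat
  assumes "prime q" "odd q" "a > 1" "t > 0"
  shows "multiplicity (int q) (a ^ ((q - 1) * t) - 1)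
    \<le> multiplicity (int q) (a ^ (q - 1) - 1) + multiplicity q t"
proof (cases "int q dvd a")
  case True
  have "q > 2" using assms(1,2) prime_ge_2_nat[of q] by (cases "q = 2") auto
  hence "int q dvd a ^ ((q - 1) * t)" using True assms(4) by (intro dvd_power_le[of _ _ 1, simplified]) auto
  hence "\<not> int q dvd a ^ ((q - 1) * t) - 1"
    using \<open>q > 2\<close> dvd_diff[of "int q" "a ^ ((q - 1) * t)" "a ^ ((q - 1) * t) - 1"] by (auto dest: zdvd_imp_le)
  thus ?thesis by (simp add: not_dvd_imp_multiplicity_0)
next
  case False
  have "q > 2" using assms(1,2) prime_ge_2_nat[of q] by (cases "q = 2") auto
  hence "a ^ (q - 1) > 1" using assms(3) by (intro one_less_power) auto
  thus ?thesis unfolding power_mult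
    using lifting_the_exponent[OF assms(1) fermat_int[OF assms(1) False] _ _ assms(4)] \<open>q > 2\<close> by auto
qed

text \<open>Let \<open>k = (q - 1) * t\<close>, and let \<open>v\<close> be the multiplicity of
  \<open>q\<close> in \<open>t\<close>. As \<open>q ^ p\<close> divides the product, lifting the
  exponent and the bound for the Fermat product give \<open>p < q + 2 * v\<close>. If
  \<open>v < j\<close>, this contradicts \<open>p \<ge> q ^ j \<ge> q + 2 * (j - 1)\<close>.\<close>

lemma prime_power_dvd_exponent:
  fixes b x :: int and p q k :: nat
  assumes b: "b \<in> {5, 7, 11, 13, 21, 23, 27, 29}"
    and eq: "(2 ^ k - 1) * (b ^ k - 1) = x ^ p" and "k > 0"
    and q: "prime q" "odd q" "(q - 1) dvd k" and "q ^ j \<le> p"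
  shows "q ^ j dvd k"
proof (rule ccontr)
  assume nd: "\<not> q ^ j dvd k"
  have b1: "b > 1" using b by auto
  have pq: "prime_elem (int q)" "prime (int q)" using q by auto
  have q3: "q \<ge> 3" using q prime_ge_2_nat[of q] by (cases "q = 2") auto
  obtain t where k: "k = (q - 1) * t" using q(3) by blast
  with \<open>k > 0\<close> have "t > 0" by simp
  define v where "v = multiplicity q t"
  have "j > 0" using nd by (cases j) auto
  have "v < j"
  proof (rule ccontr)
    assume "\<not> v < j"
    hence "q ^ j dvd t" unfolding v_def by (intro multiplicity_dvd') auto
    thus False using nd k by auto
  qed
  have pos: "a ^ n > 1" if "a > 1" "n > 0" for a :: int and n using that by (intro one_less_power) auto
  let ?m = "multiplicity (int q)"
  have "\<not> int q dvd 2" using q3 by (auto dest: zdvd_imp_le)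
  hence "int q dvd 2 ^ (q - 1) - 1" by (intro fermat_int q)
  moreover have "(2 ^ (q - 1) - 1 :: int) dvd 2 ^ k - 1"
    unfolding k power_mult by (simp add: power_diff_1_eq)
  ultimately have "int q dvd x ^ p" unfolding eq[symmetric] by (meson dvd_mult2 dvd_trans)
  hence "int q dvd x" using pq(2) prime_dvd_power by blast
  hence "int q ^ p dvd x ^ p" by (rule dvd_power_same)
  hence "int q ^ p dvd (2 ^ k - 1) * (b ^ k - 1)" by (simp add: eq)
  hence "p \<le> ?m ((2 ^ k - 1) * (b ^ k - 1))"
    using less_imp_neq[OF pos[of 2 k]] less_imp_neq[OF pos[of b k]] b1 \<open>k > 0\<close> pq
    by (intro multiplicity_geI) (auto simp: prime_elem_not_unit)
  also have "\<dots> = ?m (2 ^ k - 1) + ?m (b ^ k - 1)"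
    using less_imp_neq[OF pos[of 2 k]] less_imp_neq[OF pos[of b k]] b1 \<open>k > 0\<close> pq
    by (intro prime_elem_multiplicity_mult_distrib) auto
  also have "\<dots> \<le> (?m (2 ^ (q - 1) - 1) + v) + (?m (b ^ (q - 1) - 1) + v)"
    unfolding k v_def using q b1 \<open>t > 0\<close> by (intro add_mono multiplicity_power_minus_one) auto
  also have "\<dots> = ?m ((2 ^ (q - 1) - 1) * (b ^ (q - 1) - 1)) + 2 * v"
    using less_imp_neq[OF pos[of 2 "q - 1"]] less_imp_neq[OF pos[of b "q - 1"]] b1 q3 pq
    by (subst prime_elem_multiplicity_mult_distrib) auto
  also have "\<dots> < q + 2 * v"
    using not_power_dvd_fermat_product[OF b q(1,2)] by (auto intro!: multiplicity_lessI simp: not_le)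
  finally have "q ^ j < q + 2 * v" using \<open>q ^ j \<le> p\<close> by simp
  moreover obtain i where i: "j = Suc i" using \<open>j > 0\<close> by (cases j) auto
  moreover have "q + 2 * i \<le> q * 3 ^ i"
  proof (induction i)
    case (Suc i)
    thus ?case using q3 by simp
  qed simp
  moreover have "q * 3 ^ i \<le> q * q ^ i" using q3 by (intro mult_left_mono power_mono) auto
  ultimately show False using \<open>v < j\<close> by simp
qed

lemma not_32_dvd_square_minus_one:
  fixes b :: int
  assumes "b \<in> {5, 7, 11, 13, 21, 23, 27, 29}"
  shows "\<not> 32 dvd b\<^sup>2 - 1"
  using assms by auto

text \<open>Lifting at 2 needs a base congruent to 1 modulo 4, hence the passage to
  \<open>b^2\<close>; \<open>b^2 - 1\<close> has at most four factors 2.\<close>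

lemma two_power_dvd_even_power_minus_one:
  fixes b :: int
  assumes b: "b \<in> {5, 7, 11, 13, 21, 23, 27, 29}" and "t > 0" and dvd: "2 ^ e dvd b ^ (2 * t) - 1"
  shows "e \<le> 4 + multiplicity 2 t"
proof -
  have "4 dvd b\<^sup>2 - 1" "even (b\<^sup>2 - 1)" "b\<^sup>2 > 1" "b > 1" using b by auto
  hence *: "multiplicity 2 ((b\<^sup>2) ^ t - 1) = multiplicity 2 (b\<^sup>2 - 1) + multiplicity 2 t"
    using lifting_the_exponent[of 2 "b\<^sup>2" t] \<open>t > 0\<close> by auto
  have "b ^ (2 * t) > 1" using \<open>b > 1\<close> \<open>t > 0\<close> by (intro one_less_power) auto
  hence "e \<le> multiplicity 2 (b ^ (2 * t) - 1)"
    using dvd by (intro multiplicity_geI) auto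
  also have "\<dots> = multiplicity 2 (b\<^sup>2 - 1) + multiplicity 2 t"
    using * by (simp add: power_mult)
  also have "multiplicity 2 (b\<^sup>2 - 1) < 5"
    using not_32_dvd_square_minus_one[OF b] by (intro multiplicity_lessI) auto
  finally show ?thesis by simp
qed

lemma two_power_multiplicity_le: "t > 0 \<Longrightarrow> 2 ^ multiplicity 2 t \<le> (t :: nat)"
  by (intro dvd_imp_le multiplicity_dvd)

lemma two_power_dvd_exponent:
  fixes b x :: int and p k :: nat
  assumes b: "b \<in> {5, 7, 11, 13, 21, 23, 27, 29}"
    and eq: "(2 ^ k - 1) * (b ^ k - 1) = x ^ p" and "k > 0" "even k" "odd p" and "2 ^ j \<le> p"
  shows "2 ^ j dvd k"
proof (cases "j \<le> 1")
  case True
  thus ?thesis using \<open>even k\<close> by (cases j) auto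
next
  case False
  obtain t where k: "k = 2 * t" using \<open>even k\<close> by blast
  have "t > 0" using k \<open>k > 0\<close> by simp
  have "odd b" using b by auto
  hence "even (x ^ p)" unfolding eq[symmetric] by simp
  hence "even x" by simp
  hence "2 ^ p dvd x ^ p" by (rule dvd_power_same)
  moreover have "coprime (2 ^ p) (2 ^ k - 1 :: int)" using \<open>k > 0\<close> by simp
  ultimately have "2 ^ p dvd b ^ (2 * t) - 1"
    unfolding eq[symmetric] k by (simp add: coprime_dvd_mult_right_iff)
  hence p: "p \<le> 4 + multiplicity 2 t" using b \<open>t > 0\<close> by (intro two_power_dvd_even_power_minus_one)
  \<comment> \<open>Strictness matters: from \<open>2 ^ j \<le> 3 + multiplicity 2 t\<close> and
    \<open>2 ^ j > 3 + (j - 2)\<close> follows the multiplicity \<open>j - 1\<close> needed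
    below.\<close>
  have "2 ^ j \<noteq> p" using \<open>odd p\<close> False by (cases j) auto
  with \<open>2 ^ j \<le> p\<close> have p': "2 ^ j < p" by simp
  obtain i where i: "j = i + 2" using False by (metis add.commute le_Suc_ex not_less_eq_eq numeral_2_eq_2 One_nat_def)
  have "3 + i < 2 ^ (i + 2)" for i :: nat by (induction i) auto
  from this[of i] i p p' have "j - 1 \<le> multiplicity 2 t" by simp
  hence "2 ^ (j - 1) dvd t" by (rule multiplicity_dvd')
  hence "2 * 2 ^ (j - 1) dvd k" unfolding k by (rule mult_dvd_mono[OF dvd_refl])
  thus ?thesis using False by (cases j) auto
qed

text \<open>Strong induction on \<open>m\<close>, split as \<open>q ^ j * u\<close> with
  \<open>u\<close> prime to \<open>q\<close>. The induction hypothesis yields not only that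
  \<open>u\<close> divides \<open>k\<close> but also, for odd \<open>q\<close>, that
  \<open>q - 1\<close> does, which is what the prime power lemma requires.\<close>

lemma all_le_dvd_exponent:
  fixes b x :: int and p k :: nat
  assumes b: "b \<in> {5, 7, 11, 13, 21, 23, 27, 29}"
    and eq: "(2 ^ k - 1) * (b ^ k - 1) = x ^ p" and "k > 0" "even k" "odd p"
  shows "\<lbrakk>0 < m; m \<le> p\<rbrakk> \<Longrightarrow> m dvd k"
proof (induction m rule: less_induct)
  case (less m)
  show ?case
  proof (cases "m = 1")
    case False
    then obtain q where q: "prime q" "q dvd m" using prime_factor_nat by blast
    define j where "j = multiplicity q m"
    obtain u where m: "m = q ^ j * u" and u: "\<not> q dvd u"
      using q less.prems unfolding j_def
      by (metis multiplicity_decompose' not_gr_zero not_prime_unit)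
    have "j > 0" using q(2) m u by (cases j) auto
    have "q > 1" using q prime_gt_1_nat by blast
    have "u > 0" using m less.prems by (cases u) auto
    have "u < m" using \<open>u > 0\<close> one_less_power[OF \<open>q > 1\<close> \<open>j > 0\<close>] unfolding m by simp
    hence "u dvd k" using less \<open>u > 0\<close> by simp
    have "q ^ j \<le> m" "q \<le> m" using m \<open>u > 0\<close> q less.prems by (auto intro: dvd_imp_le)
    have "q ^ j dvd k"
    proof (cases "q = 2")
      case True
      thus ?thesis
        using two_power_dvd_exponent[OF b eq] assms(3-) \<open>q ^ j \<le> m\<close> \<open>m \<le> p\<close> by simp
    next
      case False
      hence "odd q" using q primes_dvd_imp_eq two_is_prime_nat by blast
      moreover have "q - 1 dvd k" using less \<open>q > 1\<close> \<open>q \<le> m\<close> by simp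
      ultimately show ?thesis
        using prime_power_dvd_exponent[OF b eq] \<open>k > 0\<close> q \<open>q ^ j \<le> m\<close> \<open>m \<le> p\<close> by simp
    qed
    moreover have "coprime (q ^ j) u" using q u by (simp add: prime_imp_coprime)
    ultimately show ?thesis unfolding m using \<open>u dvd k\<close> by (simp add: divides_mult)
  qed simp
qed

text \<open>As \<open>p \<ge> 3\<close> and \<open>x\<close> is even, 8 divides
  \<open>b ^ k - 1\<close>. For odd \<open>k\<close> this would give \<open>b = 1\<close> modulo 8,
  which no listed \<open>b\<close> satisfies.\<close>

lemma exponent_even:
  fixes b x :: int and p k :: nat
  assumes b: "b \<in> {5, 7, 11, 13, 21, 23, 27, 29}"
    and eq: "(2 ^ k - 1) * (b ^ k - 1) = x ^ p" and "k > 0" "p \<ge> 3"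
  shows "even k"
proof (rule ccontr)
  assume "odd k"
  then obtain t where k: "k = 2 * t + 1" by (elim oddE)
  have "odd b" using b by auto
  hence "even (x ^ p)" unfolding eq[symmetric] by simp
  hence "2 ^ p dvd x ^ p" by (auto intro: dvd_power_same)
  moreover have "(2::int) ^ 3 dvd 2 ^ p" using \<open>p \<ge> 3\<close> by (rule le_imp_power_dvd)
  ultimately have "2 ^ 3 dvd (2 ^ k - 1) * (b ^ k - 1)" unfolding eq by (rule dvd_trans[rotated])
  moreover have "coprime (2 ^ 3) (2 ^ k - 1 :: int)"
    unfolding coprime_power_left_iff using \<open>k > 0\<close> by simp
  ultimately have "2 ^ 3 dvd b ^ k - 1" by (simp only: coprime_dvd_mult_right_iff)
  hence "[b ^ k = 1] (mod 8)" by (simp add: cong_iff_dvd_diff)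
  moreover have "[b ^ k = b] (mod 8)"
  proof -
    have "[b\<^sup>2 = 1] (mod 8)" using b by (auto simp: cong_def)
    from cong_scalar_left[OF cong_pow[OF this, of t], of b] show ?thesis
      by (simp add: k power_mult)
  qed
  ultimately have "[b = 1] (mod 8)" by (metis cong_sym cong_trans)
  thus False using b by (auto simp: cong_def)
qed

section \<open>Squares with odd \<open>k\<close>: congruences\<close>

lemma square_mod_4: "(x::int)\<^sup>2 mod 4 \<in> {0, 1}"
proof -
  have "x mod 4 \<in> {0, 1, 2, 3}" by auto
  hence "(x mod 4)\<^sup>2 mod 4 \<in> {0, 1}" by auto
  thus ?thesis by (simp add: power_mod)
qed

lemma square_mod_3: "(x::int)\<^sup>2 mod 3 \<in> {0, 1}"
proof -
  have "x mod 3 \<in> {0, 1, 2}" by auto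
  hence "(x mod 3)\<^sup>2 mod 3 \<in> {0, 1}" by auto
  thus ?thesis by (simp add: power_mod)
qed

lemma square_mod_5: "(x::int)\<^sup>2 mod 5 \<in> {0, 1, 4}"
proof -
  have "x mod 5 \<in> {0, 1, 2, 3, 4}" by auto
  hence "(x mod 5)\<^sup>2 mod 5 \<in> {0, 1, 4}" by auto
  thus ?thesis by (simp add: power_mod)
qed

lemma square_mod_32: "(x::int)\<^sup>2 mod 32 \<in> {0, 1, 4, 9, 16, 17, 25}"
proof -
  have "x mod 32 \<in> set [0..31]" by simp
  moreover have "\<forall>y\<in>set [0..31]. y\<^sup>2 mod 32 \<in> {0, 1, 4, 9, 16, 17, 25 :: int}"
    by code_simp
  ultimately have "(x mod 32)\<^sup>2 mod 32 \<in> {0, 1, 4, 9, 16, 17, 25}" by blast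
  thus ?thesis by (simp add: power_mod)
qed

lemma power_mod_period:
  fixes a m :: int
  assumes "a ^ c mod m = 1"
  shows "a ^ (c * t + r) mod m = a ^ r mod m"
proof -
  have "a ^ (c * t + r) mod m = ((a ^ c mod m) ^ t mod m) * a ^ r mod m"
    by (simp add: power_add power_mult power_mod mod_simps)
  thus ?thesis using assms by (simp add: mod_simps)
qed

text \<open>Modulo 4 excludes 7, 11, 23 and 27, modulo 3 excludes 21, and modulo 5 excludes 13. For
  5 and 29, modulo 5 only fixes \<open>k\<close> modulo 4; the residues 12 and 28 modulo 32 then
  finish.\<close>

lemma odd_exponent_not_square:
  fixes b x :: int and k :: nat
  assumes b: "b \<in> {5, 7, 11, 13, 21, 23, 27, 29}" and "odd k" "k \<ge> 2"
  shows "(2 ^ k - 1) * (b ^ k - 1) \<noteq> x\<^sup>2"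
proof
  assume eq: "(2 ^ k - 1) * (b ^ k - 1) = x\<^sup>2"
  have md: "x\<^sup>2 mod m = ((2 ^ k mod m) - 1) * ((b ^ k mod m) - 1) mod m" for m
    unfolding eq[symmetric] by (rule mod_mult_cong) (simp_all only: mod_diff_left_eq)
  \<comment> \<open>Eight is a common period of all the powers reduced below modulo 3, 5 and 32,
    apart from those that vanish.\<close>
  have "k = 8 * (k div 8) + k mod 8" "k mod 8 < 8" "odd (k mod 8)"
    using \<open>odd k\<close> by (auto simp: dvd_mod_iff)
  then obtain t r where k: "k = 8 * t + r" and "r < 8" "odd r" by blast
  hence "r = 1 \<or> r = 3 \<or> r = 5 \<or> r = 7" by presburger
  hence r: "r \<in> {1, 3, 5, 7}" by simp
  have period: "(2::int) ^ k mod 3 = 2 ^ r mod 3" "(2::int) ^ k mod 5 = 2 ^ r mod 5"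
    "(13::int) ^ k mod 5 = 13 ^ r mod 5" "(29::int) ^ k mod 5 = 29 ^ r mod 5"
    "(5::int) ^ k mod 32 = 5 ^ r mod 32" "(29::int) ^ k mod 32 = 29 ^ r mod 32"
    unfolding k by (rule power_mod_period, simp)+
  have two: "(2::int) ^ k mod 2 ^ e = 0" if "e \<le> k" for e
    using that by (simp add: le_imp_power_dvd)
  consider "b mod 4 = 3" | "b = 21" | "b = 13" | "b = 5" | "b = 29" using b by auto
  thus False
  proof cases
    case 1
    have "b ^ k mod 4 = 3"
    proof -
      have "[b = - 1] (mod 4)" using 1 by (simp add: cong_def)
      from cong_pow[OF this, of k] show ?thesis using \<open>odd k\<close> by (simp add: cong_def)
    qed
    hence "x\<^sup>2 mod 4 = 2" using md[of 4] two[of 2] \<open>k \<ge> 2\<close> by simp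
    thus False using square_mod_4[of x] by simp
  next
    case 2
    have "(2::int) ^ k mod 3 = 2" using period(1) r by auto
    moreover have "(21::int) ^ k mod 3 = 0" using power_mod[of "21::int" 3 k] \<open>k \<ge> 2\<close> by (simp add: power_0_left)
    ultimately have "x\<^sup>2 mod 3 = 2" using md[of 3] 2 by simp
    thus False using square_mod_3[of x] by simp
  next
    case 3
    have "x\<^sup>2 mod 5 = 2"
      using md[of 5] period(2,3) r 3 by auto
    thus False using square_mod_5[of x] by simp
  next
    case 4
    have "r \<in> {1, 5}"
    proof (rule ccontr)
      assume "r \<notin> {1, 5}"
      with r have "r \<in> {3, 7}" by simp
      hence "x\<^sup>2 mod 5 \<in> {2, 3}"
        using md[of 5] period(2) power_mod[of "5::int" 5 k] 4 \<open>k \<ge> 2\<close> by (auto simp: power_0_left)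
      thus False using square_mod_5[of x] by auto
    qed
    moreover from this have "k \<ge> 5" using \<open>k \<ge> 2\<close> k by (cases t) auto
    ultimately have "x\<^sup>2 mod 32 \<in> {12, 28}"
      using md[of 32] two[of 5] period(5) 4 by auto
    thus False using square_mod_32[of x] by auto
  next
    case 5
    have "r \<in> {3, 7}"
    proof (rule ccontr)
      assume "r \<notin> {3, 7}"
      with r have "r \<in> {1, 5}" by simp
      hence "x\<^sup>2 mod 5 \<in> {2, 3}"
        using md[of 5] period(2,4) 5 by auto
      thus False using square_mod_5[of x] by auto
    qed
    \<comment> \<open>For \<open>k = 3\<close> the first factor is 7 rather than -1 modulo 32, but
      the product is still 28.\<close>
    moreover have "2 ^ k mod 32 = (0::int) \<or> k = 3"
      using two[of 5] k calculation by (cases t) auto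
    ultimately have "x\<^sup>2 mod 32 \<in> {12, 28}"
      using md[of 32] period(6) 5 by auto
    thus False using square_mod_32[of x] by auto
  qed
qed

section \<open>Squares with even \<open>k\<close>: a 2-adic descent\<close>

text \<open>The invariant of the descent. In terms of the 2-adic valuation \<open>v\<close>:
  \<open>v X = v Y\<close> if both are even, and \<open>v (Y^2 - 1) \<ge> 2 * v X + 2\<close> if
  \<open>Y\<close> is odd, with the mirror image. The application uses only the clause for odd
  \<open>Y\<close>; the others close the induction.\<close>

definition two_adic_link :: "int \<Rightarrow> int \<Rightarrow> bool" where
  "two_adic_link X Y \<longleftrightarrow>
     (even X \<longrightarrow> even Y \<longrightarrow> (\<forall>e. 2 ^ e dvd X \<longleftrightarrow> 2 ^ e dvd Y)) \<and>
     (odd Y \<longrightarrow> (\<forall>e. 2 ^ e dvd X \<longrightarrow> 4 ^ Suc e dvd Y\<^sup>2 - 1)) \<and>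
     (odd X \<longrightarrow> (\<forall>e. 2 ^ e dvd Y \<longrightarrow> 4 ^ Suc e dvd X\<^sup>2 - 1))"

lemma two_adic_link_commute: "two_adic_link X Y \<longleftrightarrow> two_adic_link Y X"
  unfolding two_adic_link_def by blast

lemma four_dvd_odd_square_minus_one: "odd (Y::int) \<Longrightarrow> 4 dvd Y\<^sup>2 - 1"
  by (elim oddE) (simp add: power2_eq_square algebra_simps)

lemma power_dvd_odd: "odd (Y::int) \<Longrightarrow> 2 ^ e dvd Y \<Longrightarrow> e = 0"
  by (cases e) (auto dest: dvd_mult_left)

lemma two_adic_link_odd:
  assumes "odd X" "odd Y"
  shows "two_adic_link X Y"
proof -
  have "4 ^ Suc e dvd V\<^sup>2 - 1" if "odd U" "odd V" "2 ^ e dvd U" for U V :: int and e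
    using power_dvd_odd[OF that(1,3)] four_dvd_odd_square_minus_one[OF that(2)] by simp
  thus ?thesis unfolding two_adic_link_def using assms by blast
qed

lemma two_power_dvd_iff: "odd u \<Longrightarrow> 2 ^ e dvd 2 ^ a * (u::int) \<longleftrightarrow> e \<le> a"
proof
  assume u: "odd u" and "2 ^ e dvd 2 ^ a * u"
  hence "2 ^ e dvd (2::int) ^ a" by (simp add: coprime_dvd_mult_left_iff)
  hence "(2::int) ^ e \<le> 2 ^ a" by (rule zdvd_imp_le) simp
  thus "e \<le> a" by simp
qed (simp add: le_imp_power_dvd)

lemma odd_part:
  fixes X :: int
  assumes "X \<noteq> 0"
  obtains a u where "X = 2 ^ a * u" "odd u"
  using multiplicity_decompose'[of X 2] assms by (metis odd_one)

text \<open>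
  With \<open>Z = X Y - x\<close>, the equation \<open>(X\<^sup>2 - 1) (Y\<^sup>2 - 1) = x\<^sup>2\<close> becomes the symmetric
  equation \<open>X\<^sup>2 + Y\<^sup>2 + Z\<^sup>2 = 2 X Y Z + 1\<close>, and replacing \<open>Y\<close> by \<open>Z\<close> is a descent.
\<close>

lemma markov_odd_entry:
  fixes X Y Z :: int
  assumes eq: "X\<^sup>2 + Y\<^sup>2 + Z\<^sup>2 = 2 * X * Y * Z + 1" and "odd Y" "X \<noteq> 0" "Z \<noteq> 0"
    and link: "\<And>e. 2 ^ e dvd X \<longleftrightarrow> 2 ^ e dvd Z" and "2 ^ e dvd X"
  shows "4 ^ Suc e dvd Y\<^sup>2 - 1"
proof -
  obtain a u where X: "X = 2 ^ a * u" and u: "odd u" using odd_part[OF \<open>X \<noteq> 0\<close>] .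
  obtain c w where Z: "Z = 2 ^ c * w" and w: "odd w" using odd_part[OF \<open>Z \<noteq> 0\<close>] .
  have "c = a" using link[of a] link[of c] unfolding X Z using u w
    by (simp add: two_power_dvd_iff)
  have four: "(2 ^ a)\<^sup>2 = (4::int) ^ a" by (simp add: power2_eq_square flip: power_mult_distrib)
  have "Y\<^sup>2 - 1 = 2 * X * Y * Z - X\<^sup>2 - Z\<^sup>2" using eq by simp
  also have "\<dots> = (2 ^ a)\<^sup>2 * (2 * u * w * Y - u\<^sup>2 - w\<^sup>2)"
    unfolding X Z \<open>c = a\<close> by (simp add: power2_eq_square algebra_simps)
  finally have "Y\<^sup>2 - 1 = 4 ^ a * (2 * u * w * Y - u\<^sup>2 - w\<^sup>2)" unfolding four .
  \<comment> \<open>Modulo 4, the odd values give \<open>2 - 1 - 1 = 0\<close>; this supplies the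
    extra factor 4.\<close>
  moreover have "4 dvd 2 * u * w * Y - u\<^sup>2 - w\<^sup>2"
  proof -
    obtain u' w' Y' where "u = 2 * u' + 1" "w = 2 * w' + 1" "Y = 2 * Y' + 1"
      using u w \<open>odd Y\<close> by (auto elim!: oddE)
    thus ?thesis by (simp add: power2_eq_square algebra_simps)
  qed
  ultimately have "4 ^ a * 4 dvd Y\<^sup>2 - 1" by (simp add: mult_dvd_mono)
  moreover have "e \<le> a" using \<open>2 ^ e dvd X\<close> u unfolding X by (simp add: two_power_dvd_iff)
  hence "(4::int) ^ Suc e dvd 4 ^ Suc a" by (simp add: le_imp_power_dvd)
  ultimately show ?thesis by (auto intro: dvd_trans simp: mult.commute)
qed

text \<open>In \<open>X^2 + Y^2 + (Z^2 - 1) = 2 * X * Y * Z\<close> the bracket is divisible by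
  \<open>4 ^ (a + 1)\<close>, where \<open>2 ^ a\<close> is the 2-part of \<open>X\<close>. If the
  2-parts of \<open>X\<close> and \<open>Y\<close> differed, dividing by the square of the smaller
  one would leave a single odd term.\<close>

lemma markov_even_entries:
  fixes X Y Z :: int
  assumes eq: "X\<^sup>2 + Y\<^sup>2 + Z\<^sup>2 = 2 * X * Y * Z + 1" and "X \<noteq> 0" "Y \<noteq> 0"
    and link: "\<And>e. 2 ^ e dvd X \<Longrightarrow> 4 ^ Suc e dvd Z\<^sup>2 - 1"
  shows "2 ^ e dvd X \<longleftrightarrow> 2 ^ e dvd Y"
proof -
  obtain a u where X: "X = 2 ^ a * u" and u: "odd u" using odd_part[OF \<open>X \<noteq> 0\<close>] .
  obtain c w where Y: "Y = 2 ^ c * w" and w: "odd w" using odd_part[OF \<open>Y \<noteq> 0\<close>] .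
  have "4 ^ Suc a dvd Z\<^sup>2 - 1" using link[of a] X by simp
  moreover have "(4::int) ^ Suc a = 4 * (2 ^ a)\<^sup>2" by (simp add: power2_eq_square flip: power_mult_distrib)
  ultimately obtain s where s: "Z\<^sup>2 - 1 = 4 * (2 ^ a)\<^sup>2 * s" by (auto elim!: dvdE)
  hence main: "(2 ^ a * u)\<^sup>2 + (2 ^ c * w)\<^sup>2 + 4 * (2 ^ a)\<^sup>2 * s = 2 * (2 ^ a * u) * (2 ^ c * w) * Z"
    using eq unfolding X Y by simp
  have "c = a"
  proof (rule ccontr)
    assume "c \<noteq> a"
    then consider d where "c = a + Suc d" | d where "a = c + Suc d"
      by (metis less_imp_Suc_add linorder_neqE_nat add_Suc_right)
    thus False
    proof cases
      case 1
      have "(2 ^ a)\<^sup>2 * (u\<^sup>2 + 2 * (2 * (2 ^ d * w)\<^sup>2 + 2 * s)) = (2 ^ a)\<^sup>2 * (2 * (2 * u * 2 ^ d * w * Z))"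
        using main unfolding 1 by (simp add: power_add power2_eq_square algebra_simps)
      hence "u\<^sup>2 + 2 * (2 * (2 ^ d * w)\<^sup>2 + 2 * s) = 2 * (2 * u * 2 ^ d * w * Z)" by simp
      hence "even (u\<^sup>2)" by (metis dvd_triv_left even_add)
      thus False using u by simp
    next
      case 2
      have "(2 ^ c)\<^sup>2 * (w\<^sup>2 + 2 * (2 * (2 ^ d * u)\<^sup>2 + 8 * (2 ^ d)\<^sup>2 * s)) =
          (2 ^ c)\<^sup>2 * (2 * (2 * u * 2 ^ d * w * Z))"
        using main unfolding 2 by (simp add: power_add power2_eq_square algebra_simps)
      hence "w\<^sup>2 + 2 * (2 * (2 ^ d * u)\<^sup>2 + 8 * (2 ^ d)\<^sup>2 * s) = 2 * (2 * u * 2 ^ d * w * Z)" by simp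
      hence "even (w\<^sup>2)" by (metis dvd_triv_left even_add)
      thus False using w by simp
    qed
  qed
  thus ?thesis unfolding X Y using u w by (simp add: two_power_dvd_iff)
qed

lemma two_adic_link_step:
  fixes X Y Z :: int
  assumes eq: "X\<^sup>2 + Y\<^sup>2 + Z\<^sup>2 = 2 * X * Y * Z + 1" and nz: "X \<noteq> 0" "Y \<noteq> 0" "Z \<noteq> 0"
    and link: "two_adic_link X Z"
  shows "two_adic_link X Y"
proof -
  have "even (X\<^sup>2 + Y\<^sup>2 + Z\<^sup>2 + 1)" unfolding eq by simp
  hence par: "even (X + Y + Z + 1)" by simp
  note L = link[unfolded two_adic_link_def]
  consider "odd X" "odd Y" | "even X" "odd Y" | "even X" "even Y" | "odd X" "even Y" by blast
  thus ?thesis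
  proof cases
    case 1
    thus ?thesis by (rule two_adic_link_odd)
  next
    case 2
    with par have "even Z" by simp
    with L 2 have "2 ^ e dvd X \<longleftrightarrow> 2 ^ e dvd Z" for e by blast
    from markov_odd_entry[OF eq _ _ _ this] 2 nz show ?thesis unfolding two_adic_link_def by blast
  next
    case 3
    with par have "odd Z" by simp
    with L 3 have "2 ^ e dvd X \<Longrightarrow> 4 ^ Suc e dvd Z\<^sup>2 - 1" for e by blast
    from markov_even_entries[OF eq _ _ this] 3 nz show ?thesis unfolding two_adic_link_def by blast
  next
    case 4
    with par have "even Z" by simp
    \<comment> \<open>Here \<open>X\<close> is the odd entry: exchanging \<open>X\<close> and
      \<open>Z\<close> shows that \<open>Y\<close> has the same 2-part as \<open>Z\<close>, so the
      bound for \<open>X^2 - 1\<close> passes from \<open>Z\<close> to \<open>Y\<close>.\<close>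
    have eq': "Z\<^sup>2 + Y\<^sup>2 + X\<^sup>2 = 2 * Z * Y * X + 1" using eq by (simp add: algebra_simps)
    from L 4 have *: "2 ^ e dvd Z \<Longrightarrow> 4 ^ Suc e dvd X\<^sup>2 - 1" for e by blast
    from markov_even_entries[OF eq' _ _ this] 4 nz * show ?thesis unfolding two_adic_link_def by blast
  qed
qed

text \<open>Descent on \<open>X + Y\<close>, with \<open>X \<le> Y\<close> by symmetry. For
  \<open>1 < X < Y\<close> the larger entry is replaced by \<open>Z\<close>; here
  \<open>\<bar>x\<bar> < X * Y\<close> gives \<open>Z \<ge> 1\<close>, and
  \<open>\<bar>x\<bar> > (X - 1) * Y\<close> gives \<open>Z < Y\<close>.\<close>

lemma pell_two_adic_link:
  fixes X Y x :: int
  assumes "X \<ge> 1" "Y \<ge> 1" "(X\<^sup>2 - 1) * (Y\<^sup>2 - 1) = x\<^sup>2"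
  shows "two_adic_link X Y"
  using assms
proof (induction "nat (X + Y)" arbitrary: X Y x rule: less_induct)
  case less
  have *: "two_adic_link X Y"
    if X: "X \<ge> 1" "X \<le> Y" and eq0: "(X\<^sup>2 - 1) * (Y\<^sup>2 - 1) = x\<^sup>2"
      and IH: "\<And>Z z. \<lbrakk>1 \<le> Z; Z < Y; (X\<^sup>2 - 1) * (Z\<^sup>2 - 1) = z\<^sup>2\<rbrakk> \<Longrightarrow> two_adic_link X Z"
    for X Y :: int
  proof -
    consider "X = 1" | "X = Y" | "1 < X" "X < Y" using X by linarith
    thus ?thesis
    proof cases
      case 1
      thus ?thesis using two_adic_link_odd[of X Y]
        by (cases "even Y") (auto simp: two_adic_link_def)
    next
      case 2
      thus ?thesis using two_adic_link_odd[of X Y]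
        by (cases "even Y") (auto simp: two_adic_link_def)
    next
      case 3
      have eq: "(X\<^sup>2 - 1) * (Y\<^sup>2 - 1) = \<bar>x\<bar>\<^sup>2" using eq0 by simp
      \<comment> \<open>The smaller root of the Markov-type equation regarded as a quadratic in its
        third variable; the absolute value selects it whatever the sign of \<open>x\<close>.\<close>
      define Z where "Z = X * Y - \<bar>x\<bar>"
      have markov: "X\<^sup>2 + Y\<^sup>2 + Z\<^sup>2 = 2 * X * Y * Z + 1"
        using eq unfolding Z_def by (simp add: power2_eq_square algebra_simps)
      have "\<bar>x\<bar>\<^sup>2 < (X * Y)\<^sup>2"
      proof -
        have "X\<^sup>2 \<ge> 1" "Y\<^sup>2 > 1" using 3 by (auto simp: one_less_power)
        thus ?thesis unfolding eq[symmetric] by (simp add: algebra_simps power_mult_distrib)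
      qed
      hence "\<bar>x\<bar> < X * Y" by (rule power2_less_imp_less) (use 3 in simp)
      hence "1 \<le> Z" unfolding Z_def by simp
      have "((X - 1) * Y)\<^sup>2 < \<bar>x\<bar>\<^sup>2"
      proof -
        have "Y * Y > X * Y" "X * Y > X * 1" using 3 by (auto intro: mult_strict_left_mono)
        hence "Y\<^sup>2 * 2 > X + 1" using 3 unfolding power2_eq_square by linarith
        hence "(X - 1) * (Y\<^sup>2 * 2 - (X + 1)) > 0" using 3 by (intro mult_pos_pos) auto
        thus ?thesis unfolding eq[symmetric] by (simp add: power2_eq_square algebra_simps)
      qed
      hence "(X - 1) * Y < \<bar>x\<bar>" by (rule power2_less_imp_less) simp
      hence "Z < Y" unfolding Z_def by (simp add: algebra_simps)
      moreover have "(X\<^sup>2 - 1) * (Z\<^sup>2 - 1) = (X * Z - Y)\<^sup>2"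
        using markov by (simp add: power2_eq_square algebra_simps)
      ultimately have "two_adic_link X Z" using IH \<open>1 \<le> Z\<close> by blast
      thus ?thesis using two_adic_link_step[OF markov] 3 \<open>1 \<le> Z\<close> by simp
    qed
  qed
  show ?case
  proof (cases "X \<le> Y")
    case True
    show ?thesis
      by (rule *) (use less True in auto)
  next
    case False
    have "two_adic_link Y X"
      by (rule *) (use less False in \<open>auto simp: mult.commute\<close>)
    thus ?thesis by (simp add: two_adic_link_commute)
  qed
qed

section \<open>Squares: conclusion\<close>

lemma square_solution:
  fixes b x :: int and k :: nat
  assumes b: "b \<in> {5, 7, 11, 13, 21, 23, 27, 29}" and "k \<ge> 2" "x > 0"
    and eq: "(2 ^ k - 1) * (b ^ k - 1) = x\<^sup>2"
  shows "b = 7 \<and> k = 2 \<and> x = 12"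
proof -
  have "even k" using odd_exponent_not_square[OF b] assms by blast
  then obtain m where k: "k = 2 * m" by blast
  have m: "m > 0" using k \<open>k \<ge> 2\<close> by simp
  have "two_adic_link (2 ^ m) (b ^ m)"
  proof (rule pell_two_adic_link)
    show "((2 ^ m)\<^sup>2 - 1) * ((b ^ m)\<^sup>2 - 1) = x\<^sup>2"
      using eq unfolding k by (simp add: power_even_eq)
  qed (use b in auto)
  moreover have "odd (b ^ m)" using b by auto
  moreover have "2 ^ m dvd (2 ^ m :: int)" by simp
  ultimately have "4 ^ Suc m dvd (b ^ m)\<^sup>2 - 1" unfolding two_adic_link_def by blast
  moreover have "(4::int) ^ Suc m = 2 ^ (2 * Suc m)" by (simp only: power_mult) simp
  moreover have "(b ^ m)\<^sup>2 = b ^ (2 * m)" by (rule power_even_eq[symmetric])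
  ultimately have "2 ^ (2 * Suc m) dvd b ^ (2 * m) - 1" by (simp only:)
  \<comment> \<open>Together with \<open>multiplicity 2 m < m\<close> this gives
    \<open>2 * m + 2 < 4 + m\<close>.\<close>
  hence "2 * Suc m \<le> 4 + multiplicity 2 m" using b m by (intro two_power_dvd_even_power_minus_one)
  moreover have "multiplicity 2 m < m"
    using less_exp two_power_multiplicity_le[OF m] by (rule less_le_trans)
  ultimately have "m = 1" using m by simp
  hence k2: "k = 2" using k by simp
  have x: "3 * (b\<^sup>2 - 1) = x\<^sup>2" using eq unfolding k2 by simp
  have no: "x\<^sup>2 \<noteq> s" if "y\<^sup>2 < s" "s < (y + 1)\<^sup>2" "y \<ge> 0" for s y :: int
  proof
    assume "x\<^sup>2 = s"
    with that have "y < x" "x < y + 1"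
      using power2_less_imp_less[of y x] power2_less_imp_less[of x "y + 1"] \<open>x > 0\<close> by simp_all
    thus False by simp
  qed
  \<comment> \<open>For every other \<open>b\<close>, the value \<open>3 * (b^2 - 1)\<close> lies
    strictly between the squares of consecutive integers listed here.\<close>
  have "b = 7"
    using b x no[of 8 72] no[of 18 360] no[of 22 504] no[of 36 1320] no[of 39 1584]
      no[of 46 2184] no[of 50 2520] by auto
  with x have "x\<^sup>2 = 12\<^sup>2" by simp
  hence "x = 12" by (rule power2_eq_imp_eq) (use \<open>x > 0\<close> in simp_all)
  thus ?thesis using k2 \<open>b = 7\<close> by simp
qed

section \<open>Size estimates for odd prime exponents\<close>

lemma x_less_product:
  fixes X Y x :: int
  assumes "X \<ge> 1" "Y \<ge> 1" "x > 0" "n > 0" "(X ^ n - 1) * (Y ^ n - 1) = x ^ n"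
  shows "x < X * Y"
proof -
  have "X ^ n \<ge> 1" "Y ^ n \<ge> 1" using assms by auto
  hence "x ^ n < (X * Y) ^ n"
    unfolding assms(5)[symmetric] by (simp add: power_mult_distrib algebra_simps)
  thus ?thesis using assms by (auto intro: power_less_imp_less_base)
qed

text \<open>Put \<open>a = X * Y\<close>. Since \<open>x \<le> a - 1\<close>, the gap
  \<open>a ^ n - x ^ n = X ^ n + Y ^ n - 1\<close> is at least \<open>a ^ (n - 1)\<close>; but it is
  below \<open>2 * Y ^ n\<close>, which the ratio hypothesis bounds by
  \<open>a ^ (n - 1)\<close>.\<close>

lemma no_solution_small_ratio:
  fixes X Y x :: int
  assumes "X \<ge> 1" "X \<le> Y" "x > 0" "n > 0" and eq: "(X ^ n - 1) * (Y ^ n - 1) = x ^ n"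
    and ratio: "2 * Y \<le> X ^ (n - 1)"
  shows False
proof -
  define a where "a = X * Y"
  have a: "a > x" using x_less_product[OF _ _ assms(3-5)] assms unfolding a_def by simp
  obtain m where n: "n = Suc m" using \<open>n > 0\<close> by (cases n) auto
  have "x ^ n \<le> (a - 1) ^ n" using a \<open>x > 0\<close> by (intro power_mono) auto
  also have "\<dots> = (a - 1) * (a - 1) ^ m" by (simp add: n)
  also have "\<dots> \<le> (a - 1) * a ^ m" using a \<open>x > 0\<close> by (intro mult_left_mono power_mono) auto
  also have "\<dots> = a ^ n - a ^ m" by (simp add: n algebra_simps)
  finally have "a ^ m \<le> X ^ n + Y ^ n - 1"
    unfolding eq[symmetric] a_def by (simp add: power_mult_distrib algebra_simps)
  also have "X ^ n \<le> Y ^ n" using assms by (intro power_mono) auto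
  also have "Y ^ n + Y ^ n = (2 * Y) * Y ^ m" by (simp add: n)
  also have "\<dots> \<le> X ^ m * Y ^ m" using ratio assms n by (intro mult_right_mono) auto
  also have "\<dots> = a ^ m" by (simp add: a_def power_mult_distrib)
  finally show False by simp
qed

text \<open>
  The \<open>[1/1]\<close> Pade approximant of \<open>(1 - t)\<^bsup>1/n\<^esup>\<close> is \<open>(2n - (n+1) t) / (2n - (n-1) t)\<close>.
  At \<open>t = 1 / X\<^sup>n\<close> it approximates \<open>x / (X Y)\<close> so well that \<open>A - c\<close> below, an integer, lies strictly
  between 0 and 1.
\<close>

lemma no_solution_cube:
  fixes X Y x :: int
  assumes "X \<ge> 4" "Y \<ge> 1" "x > 0" and eq: "(X ^ 3 - 1) * (Y ^ 3 - 1) = x ^ 3"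
    and lower: "2 * X ^ 4 \<le> Y\<^sup>2" and upper: "Y \<le> X ^ 5"
  shows False
proof -
  define T where "T = X ^ 3"
  \<comment> \<open>For \<open>n = 3\<close> and \<open>t = 1 / T\<close> the approximant is
    \<open>(3 * T - 2) / (3 * T - 1)\<close>; \<open>A\<close> and \<open>c\<close> clear the
    denominators.\<close>
  define A where "A = X * Y * (3 * T - 2)"
  define c where "c = x * (3 * T - 1)"
  define U where "U = Y ^ 3 * (2 * T - 1)"
  define V where "V = T * (3 * T - 2) ^ 3"
  have T: "T \<ge> 64" using power_mono[of 4 X 3] \<open>X \<ge> 4\<close> by (simp add: T_def)
  have "X * Y \<ge> 4 * 1" using assms by (intro mult_mono) auto
  hence A: "A \<ge> 4 * 190" unfolding A_def using T by (intro mult_mono) auto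
  have c: "c > 0" using T \<open>x > 0\<close> by (simp add: c_def)
  have A3: "A ^ 3 = T * Y ^ 3 * (3 * T - 2) ^ 3" by (simp add: A_def T_def power_mult_distrib)
  have "c ^ 3 = (T - 1) * (Y ^ 3 - 1) * (3 * T - 1) ^ 3"
    unfolding c_def power_mult_distrib eq[symmetric] T_def by simp
  also have "(T - 1) * (Y ^ 3 - 1) * (3 * T - 1) ^ 3 =
      (Y ^ 3 - 1) * (T * (3 * T - 2) ^ 3 - (2 * T - 1))"
    by (simp add: power3_eq_cube algebra_simps)
  finally have diff: "A ^ 3 - c ^ 3 = U + V - (2 * T - 1)"
    unfolding A3 U_def V_def by (simp add: algebra_simps)
  \<comment> \<open>A common scale: \<open>U \<le> 2 * P\<close>, \<open>V \<le> 27 / 2 * P\<close>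
    and \<open>A^2 \<ge> 7 * P\<close>, so \<open>U + V\<close> is too small for the gap
    \<open>3 * A^2 - 3 * A + 1\<close> between consecutive cubes.\<close>
  define P where "P = X\<^sup>2 * Y\<^sup>2 * T\<^sup>2"
  have "P \<ge> 0" by (simp add: P_def)
  have "Y ^ 3 \<ge> 1" using assms by simp
  hence "U \<ge> 1 * (2 * T - 1)" unfolding U_def using T by (intro mult_right_mono) auto
  moreover have "V > 0" unfolding V_def using T by simp
  ultimately have "0 < A ^ 3 - c ^ 3" unfolding diff by simp
  hence "c ^ 3 < A ^ 3" by simp
  hence "c < A" using A by (auto intro: power_less_imp_less_base)
  hence "c ^ 3 \<le> (A - 1) ^ 3" using c by (intro power_mono) auto
  also have "\<dots> = A ^ 3 - (3 * A\<^sup>2 - 3 * A + 1)" by (simp add: power3_eq_cube power2_eq_square algebra_simps)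
  finally have "3 * A\<^sup>2 - 3 * A + 1 \<le> U + V - (2 * T - 1)"
    using diff by linarith
  moreover have "U \<le> 2 * P"
  proof -
    have "U \<le> Y ^ 3 * (2 * T)" unfolding U_def using assms by (intro mult_left_mono) auto
    also have "\<dots> = 2 * T * Y\<^sup>2 * Y" by (simp add: power3_eq_cube power2_eq_square)
    also have "\<dots> \<le> 2 * T * Y\<^sup>2 * X ^ 5" using upper T by (intro mult_left_mono) auto
    also have "\<dots> = 2 * P" by (simp add: P_def T_def eval_nat_numeral)
    finally show ?thesis .
  qed
  moreover have "2 * V \<le> 27 * P"
  proof -
    have "V \<le> T * (3 * T) ^ 3" unfolding V_def using T by (intro mult_left_mono power_mono) auto
    also have "\<dots> = 27 * T\<^sup>2 * X\<^sup>2 * X ^ 4" by (simp add: T_def eval_nat_numeral)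
    finally have "2 * V \<le> 27 * T\<^sup>2 * X\<^sup>2 * (2 * X ^ 4)" by linarith
    also have "\<dots> \<le> 27 * T\<^sup>2 * X\<^sup>2 * Y\<^sup>2" using lower by (intro mult_left_mono) auto
    finally show ?thesis by (simp add: P_def mult_ac)
  qed
  moreover have "7 * P \<le> A\<^sup>2"
  proof -
    have "(14 * T)\<^sup>2 \<le> (5 * (3 * T - 2))\<^sup>2" using T by (intro power_mono) auto
    hence "196 * T\<^sup>2 \<le> 25 * (3 * T - 2)\<^sup>2" unfolding power_mult_distrib by simp
    moreover have "T\<^sup>2 \<ge> 0" by simp
    ultimately have "7 * T\<^sup>2 \<le> (3 * T - 2)\<^sup>2" by arith
    hence "(X * Y)\<^sup>2 * (7 * T\<^sup>2) \<le> (X * Y)\<^sup>2 * (3 * T - 2)\<^sup>2" by (intro mult_left_mono) auto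
    thus ?thesis by (simp add: P_def A_def power_mult_distrib mult_ac)
  qed
  moreover have "6 * A \<le> A * A" using A by (intro mult_right_mono) auto
  ultimately show False using T \<open>P \<ge> 0\<close> by (simp add: power2_eq_square)
qed

lemma no_solution_fifth_power:
  fixes X Y x :: int
  assumes "X \<ge> 8" "x > 0" and eq: "(X ^ 5 - 1) * (Y ^ 5 - 1) = x ^ 5"
    and lower: "X\<^sup>2 \<le> Y" and upper: "Y \<le> X ^ 5"
  shows False
proof -
  define T where "T = X ^ 5"
  define A where "A = X * Y * (5 * T - 3)"
  define c where "c = x * (5 * T - 2)"
  \<comment> \<open>\<open>G\<close> is
    \<open>T * (5 * T - 3) ^ 5 - (T - 1) * (5 * T - 2) ^ 5\<close>; the order of the approximation
    cancels degrees 6, 5 and 4.\<close>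
  define G where "G = 250 * T ^ 3 - 375 * T\<^sup>2 + 189 * T - 32"
  have T: "T \<ge> 2" using power_mono[of 8 X 5] \<open>X \<ge> 8\<close> by (simp add: T_def)
  have "X\<^sup>2 > 0" using \<open>X \<ge> 8\<close> by simp
  hence Y: "Y \<ge> 1" using lower by linarith
  have "X * Y \<ge> 1 * 1" using assms(1) Y by (intro mult_mono) auto
  hence A: "A \<ge> 1 * 1" unfolding A_def using T by (intro mult_mono) auto
  have c: "c > 0" using T \<open>x > 0\<close> by (simp add: c_def)
  have A5: "A ^ 5 = T * Y ^ 5 * (5 * T - 3) ^ 5" by (simp add: A_def T_def power_mult_distrib)
  have "c ^ 5 = (T - 1) * (Y ^ 5 - 1) * (5 * T - 2) ^ 5"
    unfolding c_def power_mult_distrib eq[symmetric] T_def by simp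
  also have "\<dots> = (Y ^ 5 - 1) * (T * (5 * T - 3) ^ 5 - G)"
    by (simp add: G_def eval_nat_numeral algebra_simps)
  finally have diff: "A ^ 5 - c ^ 5 = Y ^ 5 * G + T * (5 * T - 3) ^ 5 - G"
    unfolding A5 by (simp add: algebra_simps)
  have T3: "2 * T\<^sup>2 \<le> T ^ 3" "2 * T \<le> T\<^sup>2"
    using T by (auto simp: power3_eq_cube power2_eq_square intro!: mult_right_mono)
  hence G: "0 \<le> G" "G \<le> 250 * T ^ 3" using T by (auto simp: G_def)
  have "Y ^ 5 \<ge> 1" using Y by simp
  hence "Y ^ 5 * G \<ge> 1 * G" using G by (intro mult_right_mono) auto
  moreover have "T * (5 * T - 3) ^ 5 > 0" using T by simp
  ultimately have "c ^ 5 < A ^ 5" using diff by linarith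
  hence "c < A" using A by (auto intro: power_less_imp_less_base)
  hence "c ^ 5 \<le> (A - 1) ^ 5" using c by (intro power_mono) auto
  also have "\<dots> = (A - 1) * (A - 1) ^ 4" by (simp add: eval_nat_numeral)
  also have "\<dots> \<le> (A - 1) * A ^ 4" using A by (intro mult_left_mono power_mono) auto
  also have "\<dots> = A ^ 5 - A ^ 4" by (simp add: eval_nat_numeral algebra_simps)
  finally have "A ^ 4 \<le> Y ^ 5 * G + T * (5 * T - 3) ^ 5 - G" using diff by linarith
  \<comment> \<open>The gap is at most \<open>(250 + 3125) * P\<close>, while
    \<open>A ^ 4 \<ge> 64 * 256 * P\<close>; the factor 64 comes from
    \<open>X \<ge> 8\<close>.\<close>
  moreover define P where "P = X ^ 2 * Y ^ 4 * T ^ 4"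
  have "P > 0" using Y T assms(1) by (simp add: P_def)
  moreover have "Y ^ 5 * G \<le> 250 * P"
  proof -
    have "Y ^ 5 * G \<le> Y ^ 5 * (250 * T ^ 3)" using Y G by (intro mult_left_mono) auto
    also have "\<dots> = 250 * T ^ 3 * Y ^ 4 * Y" by (simp add: eval_nat_numeral)
    also have "\<dots> \<le> 250 * T ^ 3 * Y ^ 4 * T" using upper T Y unfolding T_def[symmetric] by (intro mult_left_mono) auto
    also have "\<dots> = 250 * 1 * (Y ^ 4 * T ^ 4)" by (simp add: eval_nat_numeral)
    also have "1 \<le> X\<^sup>2" using \<open>X\<^sup>2 > 0\<close> by linarith
    hence "250 * 1 * (Y ^ 4 * T ^ 4) \<le> 250 * X\<^sup>2 * (Y ^ 4 * T ^ 4)"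
      by (intro mult_right_mono mult_left_mono) auto
    finally show ?thesis by (simp add: P_def mult_ac)
  qed
  moreover have "T * (5 * T - 3) ^ 5 \<le> 3125 * P"
  proof -
    have "T * (5 * T - 3) ^ 5 \<le> T * (5 * T) ^ 5" using T by (intro mult_left_mono power_mono) auto
    also have "\<dots> = 3125 * T ^ 4 * X\<^sup>2 * (X\<^sup>2) ^ 4" by (simp add: T_def eval_nat_numeral)
    also have "\<dots> \<le> 3125 * T ^ 4 * X\<^sup>2 * Y ^ 4" using lower T by (intro mult_left_mono power_mono) auto
    finally show ?thesis by (simp add: P_def mult_ac)
  qed
  moreover have "64 * (256 * P) \<le> A ^ 4"
  proof -
    have "8\<^sup>2 \<le> X\<^sup>2" using assms(1) by (intro power_mono) auto
    hence "64 * (256 * P) \<le> X\<^sup>2 * (256 * P)" using \<open>P > 0\<close> by (intro mult_right_mono) auto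
    also have "\<dots> = X ^ 4 * Y ^ 4 * (4 * T) ^ 4" by (simp add: P_def eval_nat_numeral)
    also have "\<dots> \<le> X ^ 4 * Y ^ 4 * (5 * T - 3) ^ 4"
    proof (cases "T \<ge> 3")
      case True
      thus ?thesis using Y assms(1) by (intro mult_left_mono power_mono) auto
    next
      case False
      thus ?thesis using power_mono[of 8 X 5] \<open>X \<ge> 8\<close> by (simp add: T_def)
    qed
    finally show ?thesis by (simp add: A_def power_mult_distrib)
  qed
  ultimately show False using G by linarith
qed

section \<open>Odd prime exponents and the final case split\<close>

lemma power_swap: "((a :: int) ^ m) ^ n = (a ^ n) ^ m"
  by (simp add: mult.commute flip: power_mult)

lemma odd_prime_exponent_impossible:
  fixes b x :: int and p k :: nat
  assumes b: "b \<in> {5, 7, 11, 13, 21, 23, 27, 29}" and "k > 0" "x > 0" and p: "prime p" "odd p"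
  shows "(2 ^ k - 1) * (b ^ k - 1) \<noteq> x ^ p"
proof
  assume eq: "(2 ^ k - 1) * (b ^ k - 1) = x ^ p"
  have p3: "p \<ge> 3" using p prime_ge_2_nat[of p] by (cases "p = 2") auto
  have "even k" using exponent_even[OF b eq \<open>k > 0\<close> p3] .
  note dvd = all_le_dvd_exponent[OF b eq \<open>k > 0\<close> \<open>even k\<close> \<open>odd p\<close>]
  from dvd[of p] p3 obtain l where k: "k = p * l" by auto
  have l: "l > 0" using k \<open>k > 0\<close> by simp
  define X Y where "X = (2::int) ^ l" and "Y = b ^ l"
  have eq': "(X ^ p - 1) * (Y ^ p - 1) = x ^ p"
    using eq unfolding k X_def Y_def power_mult power_swap[of _ p] .
  have bb: "5 \<le> b" "b \<le> 29" using b by auto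
  have XY: "1 \<le> X" "X \<le> Y" using bb unfolding X_def Y_def by (auto intro: power_mono)
  have X5: "X ^ 5 = 32 ^ l" unfolding X_def by (subst power_swap) simp
  have upper: "Y \<le> X ^ 5" using bb unfolding X5 Y_def by (intro power_mono) auto
  consider "p = 3" | "p = 5" | "p \<ge> 7"
  proof -
    have "p = 3 \<or> p = 5 \<or> p \<ge> 7" using p3 \<open>odd p\<close> by presburger
    thus ?thesis using that by blast
  qed
  thus False
  proof cases
    case 1
    have "even l" using \<open>even k\<close> unfolding k 1 by simp
    then obtain m where m: "l = 2 * m" by blast
    have "m > 0" using m l by simp
    then obtain m' where m': "m = Suc m'" by (cases m) auto
    have "4 \<le> X" unfolding X_def m m' by (simp add: power_mult)
    \<comment> \<open>With \<open>l = 2 * m\<close> and \<open>b \<ge> 5\<close> this is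
      \<open>2 * 256 ^ m \<le> 625 ^ m\<close>, true from \<open>m = 1\<close> on because
      \<open>512 \<le> 625\<close>.\<close>
    moreover have "2 * X ^ 4 \<le> Y\<^sup>2"
    proof -
      have "2 * X ^ 4 = 2 * 256 ^ m" unfolding X_def m power_mult by (subst power_swap) simp
      also have "\<dots> = 512 * 256 ^ m'" by (simp add: m')
      also have "\<dots> \<le> 625 * 625 ^ m'" by (intro mult_mono power_mono) auto
      also have "\<dots> = (5 ^ l)\<^sup>2" unfolding m m' power_mult by (subst power_swap) simp
      also have "\<dots> \<le> Y\<^sup>2" unfolding Y_def using bb by (intro power_mono) auto
      finally show ?thesis .
    qed
    ultimately show False using no_solution_cube[of X Y x] XY \<open>x > 0\<close> eq' upper unfolding 1 by simp
  next
    case 2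
    \<comment> \<open>Divisibility of \<open>k\<close> by 3 forces \<open>l \<ge> 3\<close>, hence
      \<open>X \<ge> 8\<close>.\<close>
    have "3 dvd 5 * l" using dvd[of 3] unfolding k 2 by simp
    hence "3 dvd l" by presburger
    hence "l \<ge> 3" using l by (auto dest: dvd_imp_le)
    hence "(2::int) ^ 3 \<le> X" unfolding X_def by (intro power_increasing) auto
    moreover have "X\<^sup>2 = 4 ^ l" unfolding X_def by (subst power_swap) simp
    hence "X\<^sup>2 \<le> Y" using bb unfolding Y_def by (auto intro: power_mono)
    ultimately show False using no_solution_fifth_power[of X x Y] \<open>x > 0\<close> eq' upper unfolding 2 by simp
  next
    case 3
    obtain m where m: "l = Suc m" using l by (cases l) auto
    have "2 * Y \<le> 2 * 29 ^ l" using bb unfolding Y_def by (auto intro: power_mono)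
    also have "\<dots> = 58 * 29 ^ m" by (simp add: m)
    also have "\<dots> \<le> 64 * 64 ^ m" by (intro mult_mono power_mono) auto
    also have "\<dots> = X ^ 6" unfolding X_def m by (subst power_swap) simp
    also have "\<dots> \<le> X ^ (p - 1)" using 3 XY by (intro power_increasing) auto
    finally show False using no_solution_small_ratio[OF XY \<open>x > 0\<close> _ eq'] p3 by simp
  qed
qed

theorem theorem4:
  fixes b x :: int and k n :: nat
  assumes "b \<in> {5, 7, 11, 13, 21, 23, 27, 29}"
    and "x > 0" and "k \<ge> 2" and "n \<ge> 2"
  shows "(2 ^ k - 1) * (b ^ k - 1) = x ^ n \<longleftrightarrow> b = 7 \<and> k = 2 \<and> x = 12 \<and> n = 2"
proof
  assume eq: "(2 ^ k - 1) * (b ^ k - 1) = x ^ n"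
  show "b = 7 \<and> k = 2 \<and> x = 12 \<and> n = 2"
  proof (cases "\<exists>p. prime p \<and> odd p \<and> p dvd n")
    case True
    then obtain p m where p: "prime p" "odd p" and n: "n = m * p" by (metis dvdE mult.commute)
    have "(2 ^ k - 1) * (b ^ k - 1) = (x ^ m) ^ p" using eq by (simp add: n power_mult)
    thus ?thesis using odd_prime_exponent_impossible[of b k "x ^ m" p] assms p by simp
  next
    case False
    moreover obtain p where "prime p" "p dvd n" using prime_factor_nat[of n] assms(4) by auto
    ultimately have "even n" by (metis primes_dvd_imp_eq two_is_prime_nat)
    then obtain m where n: "n = m * 2" by (metis dvdE mult.commute)
    have "m > 0" using n assms(4) by simp
    have "(2 ^ k - 1) * (b ^ k - 1) = (x ^ m)\<^sup>2" using eq by (simp add: n power_mult)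
    hence *: "b = 7 \<and> k = 2 \<and> x ^ m = 12" using square_solution[of b k "x ^ m"] assms by simp
    \<comment> \<open>The number 12 is no proper power: \<open>m \<ge> 2\<close> would make 9 divide
      it.\<close>
    have "m = 1"
    proof (rule ccontr)
      assume "m \<noteq> 1"
      with \<open>m > 0\<close> have "x\<^sup>2 dvd x ^ m" by (intro le_imp_power_dvd) simp
      have "even (x ^ m)" "3 dvd x ^ m" using * by auto
      hence "3 dvd x" using prime_dvd_power[of "3::int" x m] by simp
      hence "3\<^sup>2 dvd x\<^sup>2" by (rule dvd_power_same)
      with \<open>x\<^sup>2 dvd x ^ m\<close> have "3\<^sup>2 dvd (12::int)" using * by (metis dvd_trans)
      thus False by simp
    qed
    thus ?thesis using * n by simp
  qed
qed simp

end
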